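(* Let $0<p<1$ and let $\epsilon>0$ be a constant. Consider a fault-prone multiple access channel with beeps and per-round fault probability $p$, in which every processor executes Algorithm GlobalSync (with parameter $\gamma$) from its wake-up. Then, for every number of processors and every wake-up schedule, with probability at least $1-\epsilon$ all processors terminate Algorithm GlobalSync in the same global round $\mathtt{sync}$, and $\mathtt{sync}$ occurs $O(1)$ rounds after the first wake-up (i.e. at most $C$ rounds after it, where $C$ is a constant depending only on $p$, $\epsilon$ and the chosen constant $\gamma$, not on the number of processors or on the wake-up schedule).
   Context: **Model.** A finite nonempty set of processors shares a multiple access channel (MAC): all processors communicate directly. Communication proceeds in synchronous rounds. Some processors (at least one) wake up spontaneously, in possibly different rounds decided by an adversary; other processors stay dormant until woken by a beep. Each processor has a local clock that shows 0 in its wake-up round and advances by one per round; processors do not see any global round number. In each round an awake processor either beeps or listens (stays silent). In each round, independently, a fault occurs in the channel with probability $p$, $0<p<1$. In a fault-free round, an awake processor hears a beep if it listens in this round and one or more other processors beep in this round; a processor still dormant in a fault-free round in which some other processor beeps is woken up by this beep and hears it. In a faulty round nothing is heard and nobody is woken by a beep. A processor that wakes up spontaneously in a round is awake in that round (this is its local round 0). Probabilities are over the channel faults, for an arbitrary wake-up schedule. $p$ and $\epsilon$ are known to all processors. **Parameter.** $\gamma$ is a constant (a positive integer) such that $p^{\gamma}<\epsilon/4$. **Procedure listenVector$(t')$.** Let $num_1$ be the number of beeps heard by the processor in its local rounds $t',\dots,t'+2\gamma-1$ and $num_2$ the number heard in local rounds $t'+2\gamma,\dots,t'+4\gamma-1$.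 For $k=1,2$ put $h_k=0$ if $num_k=0$, $h_k=1$ if $num_k=1$, $h_k=*$ if $num_k>1$. Return $[h_1\ h_2]$. **Algorithm GlobalSync** (executed by each processor from its wake-up; all round numbers are local clock values; the processor listens in each round in which it is not told to beep; instructions are carried out in real time as rounds elapse): 1. If woken up by a beep in some round $heard$: beep in the $2\gamma$ consecutive rounds starting at round $heard+2\gamma+1$, and set $syncRound\leftarrow heard+4\gamma+1$. 2. Else (woken up spontaneously): set $i\leftarrow 0$, $myNextBeep\leftarrow 0$. Repeat: [ $myCurrentBeep\leftarrow myNextBeep$; beep in round $myCurrentBeep$; $i\leftarrow i+1$; $myNextBeep\leftarrow myCurrentBeep+4\gamma+i$ ] until ($i=3\gamma$) or (a beep is heard in one of the rounds $myCurrentBeep+1,\dots,myNextBeep-1$). - If $i=3\gamma$: set $syncRound\leftarrow myNextBeep$. - Else: let $heard$ be the first round after $myCurrentBeep$ in which a beep was heard, and $[h_1\ h_2]=$ listenVector$(myCurrentBeep+1)$. If $[h_1\ h_2]\in\{[0\,0],[0\,1],[1\,0],[1\,1],[1\,*]\}$: beep in the $2\gamma$ consecutive rounds starting at round $heard+2\gamma+1$ and set $syncRound\leftarrow heard+4\gamma+1$. If $[h_1\ h_2]\in\{[0\,*],[*\,0],[*\,1],[*\,*]\}$: set $syncRound\leftarrow myCurrentBeep+4\gamma+1$. (Which of these two cases applies is already determined by what is heard before round $heard+2\gamma+1$.) 3. Wait until round $syncRound$ and exit (terminate). "Global round" means a round of a fixed global numbering of rounds, unknown to the processors. *)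

theory Defs
  imports "HOL-Probability.Probability"
begin

text \<open>
  Processors are named by natural numbers only to give a single type containing finite sets of
  processors of every size; the algorithm never sees the names. Global rounds are natural numbers.
  The adversary's schedule maps a processor to the global round in which it wakes up spontaneously
  if no beep has woken it before, and to \<open>None\<close> if it never wakes up spontaneously.
\<close>

type_synonym proc = nat
type_synonym schedule = "proc \<Rightarrow> nat option"

datatype cause = Spontaneous | Beeped

text \<open>
  The algorithm of one processor is given in terms of its hearing history \<open>H\<close>: the set of
  local rounds, among those already elapsed, in which it has heard a beep.
\<close>

datatype amount = Zero | One | Many

definition amount_of :: "nat \<Rightarrow> amount" where
  "amount_of n = (if n = 0 then Zero else if n = 1 then One else Many)"

definition listen_vector :: "nat \<Rightarrow> nat set \<Rightarrow> nat \<Rightarrow> amount \<times> amount" where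
  "listen_vector \<gamma> H t' =
     (amount_of (card (H \<inter> {t'..<t' + 2 * \<gamma>})),
      amount_of (card (H \<inter> {t' + 2 * \<gamma>..<t' + 4 * \<gamma>})))"

text \<open>
  \<open>loop_beep \<gamma> k\<close> is the value of \<open>myCurrentBeep\<close> in the iteration of the loop that is
  entered with \<open>i = k\<close>; the value of \<open>myNextBeep\<close> computed there is \<open>loop_beep \<gamma> (Suc k)\<close>.
\<close>

primrec loop_beep :: "nat \<Rightarrow> nat \<Rightarrow> nat" where
  "loop_beep \<gamma> 0 = 0"
| "loop_beep \<gamma> (Suc k) = loop_beep \<gamma> k + 4 * \<gamma> + Suc k"

text \<open>
  The iteration (numbered by the value of \<open>i\<close> on entry) after which the loop is left. On the
  history of an initial segment of rounds this is the iteration that will be the last one if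
  nothing more is heard.
\<close>

definition last_iteration :: "nat \<Rightarrow> nat set \<Rightarrow> nat" where
  "last_iteration \<gamma> H =
     (LEAST k. Suc k = 3 * \<gamma> \<or> (\<exists>r\<in>H. loop_beep \<gamma> k < r \<and> r < loop_beep \<gamma> (Suc k)))"

definition current_beep :: "nat \<Rightarrow> nat set \<Rightarrow> nat" where
  "current_beep \<gamma> H = loop_beep \<gamma> (last_iteration \<gamma> H)"

definition loop_completed :: "nat \<Rightarrow> nat set \<Rightarrow> bool" where
  "loop_completed \<gamma> H \<longleftrightarrow> Suc (last_iteration \<gamma> H) = 3 * \<gamma>"

definition first_heard :: "nat \<Rightarrow> nat set \<Rightarrow> nat" where
  "first_heard \<gamma> H = (LEAST r. r \<in> H \<and> current_beep \<gamma> H < r)"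

definition answers :: "nat \<Rightarrow> nat set \<Rightarrow> bool" where
  "answers \<gamma> H \<longleftrightarrow> listen_vector \<gamma> H (current_beep \<gamma> H + 1) \<in>
     {(Zero, Zero), (Zero, One), (One, Zero), (One, One), (One, Many)}"

text \<open>
  A processor woken up by a beep hears that beep in its wake-up round, so its \<open>heard\<close> is the
  local round 0.
\<close>

fun sync_round :: "nat \<Rightarrow> cause \<Rightarrow> nat set \<Rightarrow> nat" where
  "sync_round \<gamma> Beeped H = 0 + 4 * \<gamma> + 1"
| "sync_round \<gamma> Spontaneous H =
     (if loop_completed \<gamma> H then loop_beep \<gamma> (Suc (last_iteration \<gamma> H))
      else if answers \<gamma> H then first_heard \<gamma> H + 4 * \<gamma> + 1
      else current_beep \<gamma> H + 4 * \<gamma> + 1)"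

text \<open>
  Whether a processor beeps in local round \<open>t\<close>, where \<open>H \<subseteq> {..<t}\<close> is what it has heard
  before. Although \<open>answers\<close> is evaluated on an unfinished history, its value no longer changes
  from round \<open>first_heard \<gamma> H + 2 * \<gamma> + 1\<close> on.
  Likewise \<open>sync_round\<close> cannot equal
  the clock too early: its value is always later than
  \<open>current_beep \<gamma> H + 4 * \<gamma>\<close>, when \<open>listen_vector\<close> is complete.
\<close>

fun beeps_in :: "nat \<Rightarrow> cause \<Rightarrow> nat set \<Rightarrow> nat \<Rightarrow> bool" where
  "beeps_in \<gamma> Beeped H t \<longleftrightarrow> t \<in> {0 + 2 * \<gamma> + 1..0 + 4 * \<gamma>}"
| "beeps_in \<gamma> Spontaneous H t \<longleftrightarrow>
     (\<exists>k\<le>last_iteration \<gamma> H. t = loop_beep \<gamma> k) \<or>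
     (\<not> loop_completed \<gamma> H \<and> answers \<gamma> H \<and>
      t \<in> {first_heard \<gamma> H + 2 * \<gamma> + 1..first_heard \<gamma> H + 4 * \<gamma>})"

text \<open>
  \<open>Active c w H\<close>: woken up in global round \<open>w\<close> by cause \<open>c\<close>, with hearing history \<open>H\<close>
  in local rounds, so that its clock shows \<open>t - w\<close> in global round \<open>t\<close>.
  \<open>Terminated r\<close>: exited in global round \<open>r\<close>.
\<close>

datatype status = Dormant | Active cause nat "nat set" | Terminated nat

text \<open>
  A global round consists of spontaneous wake-ups and exits, then beeping, then hearing and
  wake-ups by beeps.
\<close>

definition start_round :: "nat \<Rightarrow> schedule \<Rightarrow> nat \<Rightarrow> (proc \<Rightarrow> status) \<Rightarrow> proc \<Rightarrow> status" where
  "start_round \<gamma> wake t s v =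
     (case s v of
        Dormant \<Rightarrow> if wake v = Some t then Active Spontaneous t {} else Dormant
      | Active c w H \<Rightarrow> if t - w = sync_round \<gamma> c H then Terminated t else Active c w H
      | Terminated r \<Rightarrow> Terminated r)"

definition beeps :: "nat \<Rightarrow> nat \<Rightarrow> status \<Rightarrow> bool" where
  "beeps \<gamma> t x \<longleftrightarrow> (case x of Active c w H \<Rightarrow> beeps_in \<gamma> c H (t - w) | _ \<Rightarrow> False)"

definition end_round ::
    "nat \<Rightarrow> proc set \<Rightarrow> bool \<Rightarrow> nat \<Rightarrow> (proc \<Rightarrow> status) \<Rightarrow> proc \<Rightarrow> status" where
  "end_round \<gamma> V faulty t s v =
     (if \<not> faulty \<and> \<not> beeps \<gamma> t (s v) \<and> (\<exists>u\<in>V. u \<noteq> v \<and> beeps \<gamma> t (s u))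
      then (case s v of
              Dormant \<Rightarrow> Active Beeped t {0}
            | Active c w H \<Rightarrow> Active c w (insert (t - w) H)
            | Terminated r \<Rightarrow> Terminated r)
      else s v)"

text \<open>
  \<open>execution \<gamma> V wake F t\<close> gives the statuses just before global round \<open>t\<close>, where
  \<open>F t\<close> means that a fault occurs in global round \<open>t\<close>.
\<close>

primrec execution ::
    "nat \<Rightarrow> proc set \<Rightarrow> schedule \<Rightarrow> (nat \<Rightarrow> bool) \<Rightarrow> nat \<Rightarrow> proc \<Rightarrow> status" where
  "execution \<gamma> V wake F 0 = (\<lambda>v. Dormant)"
| "execution \<gamma> V wake F (Suc t) =
     end_round \<gamma> V (F t) t (start_round \<gamma> wake t (execution \<gamma> V wake F t))"

definition terminates_at ::
    "nat \<Rightarrow> proc set \<Rightarrow> schedule \<Rightarrow> (nat \<Rightarrow> bool) \<Rightarrow> proc \<Rightarrow> nat \<Rightarrow> bool" where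
  "terminates_at \<gamma> V wake F v r \<longleftrightarrow> (\<exists>t. execution \<gamma> V wake F t v = Terminated r)"

text \<open>The first wake-up is always spontaneous, so it can be read off the schedule.\<close>

definition first_wakeup :: "proc set \<Rightarrow> schedule \<Rightarrow> nat" where
  "first_wakeup V wake = (LEAST t. \<exists>v\<in>V. wake v = Some t)"

definition fault_space :: "real \<Rightarrow> (nat \<Rightarrow> bool) measure" where
  "fault_space p = PiM UNIV (\<lambda>_. measure_pmf (bernoulli_pmf p))"

end

theory Submission
  imports Defs
begin

text \<open>
  Call a round audible if, in a run in which nothing is ever heard, some but not all processors
  beep in it. Up to the first fault-free audible round \<open>\<tau>\<close> the run is deterministic. In
  round \<open>\<tau>\<close> everybody is awake: those who beep (the beepers) listen next, and all others
  have heard exactly one beep, so they answer together in rounds \<open>\<tau> + 2 * \<gamma> + 1\<close> to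
  \<open>\<tau> + 4 * \<gamma>\<close>. If both halves of this interval contain a fault-free round, the beepers
  hear at least two answers, and everybody terminates in round \<open>\<tau> + 4 * \<gamma> + 1\<close>.
  If not all processors wake up in the first round, then among any two consecutive beeps of an
  earliest processor at least one is audible, so its first \<open>2 * \<gamma>\<close> beeps contain
  \<open>\<gamma>\<close> audible ones. Hence each of the three ways to fail has probability at most
  \<open>p ^ \<gamma>\<close>.
\<close>

section \<open>The beep times of the loop\<close>

lemma strict_mono_loop_beep: "strict_mono (loop_beep \<gamma>)"
  by (simp add: strict_mono_Suc_iff)

lemmas loop_beep_less_iff = strict_mono_less[OF strict_mono_loop_beep]
lemmas loop_beep_le_iff = strict_mono_less_eq[OF strict_mono_loop_beep]
lemmas loop_beep_eq_iff = strict_mono_eq[OF strict_mono_loop_beep]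

lemma loop_beep_interval:
  obtains k where "loop_beep \<gamma> k \<le> x" "x < loop_beep \<gamma> (Suc k)"
proof -
  have "\<exists>k. loop_beep \<gamma> k \<le> x \<and> x < loop_beep \<gamma> (Suc k)"
  proof (induction x)
    case 0
    show ?case by (rule exI[of _ 0]) simp
  next
    case (Suc x)
    then obtain k where k: "loop_beep \<gamma> k \<le> x" "x < loop_beep \<gamma> (Suc k)" by blast
    show ?case
    proof (cases "Suc x < loop_beep \<gamma> (Suc k)")
      case True
      with k show ?thesis by (intro exI[of _ k]) simp
    next
      case False
      with k show ?thesis by (intro exI[of _ "Suc k"]) simp
    qed
  qed
  with that show ?thesis by blast
qed

text \<open>
  The gaps of the beep sequence differ pairwise, and each of the first \<open>4 * \<gamma>\<close> gaps is
  shorter than the sum of two others; hence two processors with different wake-up rounds never beep together twice in succession.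
\<close>

lemma no_consecutive_collisions:
  assumes "s + loop_beep \<gamma> k = w + loop_beep \<gamma> i"
    and "s + loop_beep \<gamma> (Suc k) = w + loop_beep \<gamma> j"
    and "k < 4 * \<gamma>"
  shows "w = s"
proof -
  have diff: "loop_beep \<gamma> j = loop_beep \<gamma> i + 4 * \<gamma> + Suc k"
    using assms by simp
  then have "loop_beep \<gamma> i < loop_beep \<gamma> j" by simp
  then have "i < j" by (simp only: loop_beep_less_iff)
  show ?thesis
  proof (cases "j = Suc i")
    case True
    \<comment> \<open>Gap lengths determine the iteration, so \<open>i = k\<close>; cancelling in
      the first collision leaves \<open>w = s\<close>.\<close>
    with diff assms show ?thesis by simp
  next
    case False
    with \<open>i < j\<close> have "loop_beep \<gamma> (Suc (Suc i)) \<le> loop_beep \<gamma> j"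
      by (simp only: loop_beep_le_iff)
    with diff assms(3) show ?thesis by simp
  qed
qed

section \<open>The algorithm of one processor on given hearing histories\<close>

lemma last_iteration_empty:
  assumes "0 < \<gamma>"
  shows "last_iteration \<gamma> {} = 3 * \<gamma> - 1"
  unfolding last_iteration_def by (rule Least_equality) (use assms in auto)

text \<open>The window of an earlier iteration ends at or before
  \<open>loop_beep \<gamma> k\<close>, so nothing was heard in it, and the counter cannot stop the
  loop earlier because \<open>k < 3 * \<gamma>\<close>.\<close>

lemma last_iteration_eq:
  assumes "H \<noteq> {}" "H \<subseteq> {loop_beep \<gamma> k<..<loop_beep \<gamma> (Suc k)}" "k < 3 * \<gamma>"
  shows "last_iteration \<gamma> H = k"
  unfolding last_iteration_def
proof (rule Least_equality)
  show "Suc k = 3 * \<gamma> \<or> (\<exists>r\<in>H. loop_beep \<gamma> k < r \<and> r < loop_beep \<gamma> (Suc k))"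
    using assms by fastforce
next
  fix j
  assume "Suc j = 3 * \<gamma> \<or> (\<exists>r\<in>H. loop_beep \<gamma> j < r \<and> r < loop_beep \<gamma> (Suc j))"
  then show "k \<le> j"
  proof
    assume "\<exists>r\<in>H. loop_beep \<gamma> j < r \<and> r < loop_beep \<gamma> (Suc j)"
    then obtain r where "loop_beep \<gamma> k < r" "r < loop_beep \<gamma> (Suc j)"
      using assms(2) by (meson greaterThanLessThan_iff subsetD)
    then have "loop_beep \<gamma> k < loop_beep \<gamma> (Suc j)" by (rule less_trans)
    then show ?thesis by (simp only: loop_beep_less_iff less_Suc_eq_le)
  qed (use assms in simp)
qed

lemma loop_completed_empty: "0 < \<gamma> \<Longrightarrow> loop_completed \<gamma> {}"
  by (simp add: loop_completed_def last_iteration_empty)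

lemma sync_round_empty: "0 < \<gamma> \<Longrightarrow> sync_round \<gamma> Spontaneous {} = loop_beep \<gamma> (3 * \<gamma>)"
  using loop_completed_empty[of \<gamma>]
  by (simp add: loop_completed_def del: loop_beep.simps)

lemma beeps_in_empty:
  "0 < \<gamma> \<Longrightarrow> beeps_in \<gamma> Spontaneous {} t \<longleftrightarrow> (\<exists>k<3 * \<gamma>. t = loop_beep \<gamma> k)"
  using less_Suc_eq_le[of _ "3 * \<gamma> - 1"]
  by (simp add: loop_completed_empty last_iteration_empty)

section \<open>Histories with a single heard beep\<close>

context
  fixes \<gamma> k x :: nat
  assumes x: "loop_beep \<gamma> k < x" "x < loop_beep \<gamma> (Suc k)" and k: "Suc k < 3 * \<gamma>"
begin

lemma single_last_iteration: "last_iteration \<gamma> {x} = k"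
  using x k by (intro last_iteration_eq) auto

lemma single_first_heard: "first_heard \<gamma> {x} = x"
  unfolding first_heard_def current_beep_def single_last_iteration
  by (rule Least_equality) (use x in auto)

text \<open>One beep cannot produce the entry \<open>Many\<close>, and without \<open>Many\<close>
  every vector is an answering one. If \<open>x\<close> falls into the last \<open>k\<close> rounds
  of the window, beyond both halves, the vector is \<open>(Zero, Zero)\<close>.\<close>

lemma single_answers: "answers \<gamma> {x}"
  by (auto simp: answers_def listen_vector_def amount_of_def current_beep_def single_last_iteration)

text \<open>Here \<open>Suc k < 3 * \<gamma>\<close> matters: in the final iteration the loop counts
  as completed even if a beep is heard.\<close>

lemma single_sync_round: "sync_round \<gamma> Spontaneous {x} = x + 4 * \<gamma> + 1"
  using k by (simp add: loop_completed_def single_last_iteration single_first_heard single_answers)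

lemma single_beeps_in:
  assumes "x < t"
  shows "beeps_in \<gamma> Spontaneous {x} t \<longleftrightarrow> t \<in> {x + 2 * \<gamma> + 1..x + 4 * \<gamma>}"
proof -
  have "t \<noteq> loop_beep \<gamma> i" if "i \<le> k" for i
    using that x(1) assms loop_beep_le_iff[of \<gamma> i k] by linarith
  then show ?thesis
    using k by (auto simp: loop_completed_def single_last_iteration single_first_heard single_answers)
qed

end

section \<open>Histories confined to the second half of the listening interval\<close>

context
  fixes \<gamma> k :: nat and H :: "nat set"
  assumes H: "H \<subseteq> {loop_beep \<gamma> k + 2 * \<gamma> + 1..loop_beep \<gamma> k + 4 * \<gamma>}" and k: "Suc k < 3 * \<gamma>"
begin

lemma late_last_iteration: "H \<noteq> {} \<Longrightarrow> last_iteration \<gamma> H = k"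
  using H k by (intro last_iteration_eq) auto

lemma late_first_heard: 
  assumes "H \<noteq> {}"
  shows "loop_beep \<gamma> k + 2 * \<gamma> + 1 \<le> first_heard \<gamma> H"
proof -
  obtain r where "r \<in> H" using assms by blast
  then have "r \<in> H \<and> current_beep \<gamma> H < r"
    using H by (auto simp: current_beep_def late_last_iteration[OF assms])
  then have "first_heard \<gamma> H \<in> H"
    unfolding first_heard_def by (rule LeastI2) simp
  then show ?thesis using H by auto
qed

text \<open>After a single answer the vector is \<open>(Zero, One)\<close>, so
  \<open>answers\<close> holds provisionally. This does no harm: the processor's own answer would
  start at least \<open>2 * \<gamma> + 1\<close> rounds after \<open>first_heard\<close>, which is
  beyond \<open>loop_beep \<gamma> k + 4 * \<gamma>\<close>. The next beep of the loop is later as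
  well.\<close>

lemma late_not_beeps_in:
  assumes "loop_beep \<gamma> k < t" "t \<le> loop_beep \<gamma> k + 4 * \<gamma>"
  shows "\<not> beeps_in \<gamma> Spontaneous H t"
proof -
  have no_loop: "t \<noteq> loop_beep \<gamma> i" for i
  proof
    assume t: "t = loop_beep \<gamma> i"
    with assms have "loop_beep \<gamma> k < loop_beep \<gamma> i" "loop_beep \<gamma> i < loop_beep \<gamma> (Suc k)" by simp_all
    then show False by (simp only: loop_beep_less_iff)
  qed
  show ?thesis
  proof (cases "H = {}")
    case True
    with k no_loop show ?thesis by (simp add: beeps_in_empty del: beeps_in.simps)
  next
    case False
    with no_loop late_first_heard assms show ?thesis by auto
  qed
qed

text \<open>Excludes an exit before the answering interval is over, also while \<open>H\<close> is
  still empty and the loop looks as if it would be completed.\<close>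

lemma late_sync_round:
  "loop_beep \<gamma> k + 4 * \<gamma> < sync_round \<gamma> Spontaneous H"
proof (cases "H = {}")
  case True
  have "loop_beep \<gamma> (Suc k) < loop_beep \<gamma> (3 * \<gamma>)"
    using k by (simp only: loop_beep_less_iff)
  with True k show ?thesis by (simp add: sync_round_empty del: sync_round.simps)
next
  case False
  with k late_first_heard show ?thesis
    by (simp add: loop_completed_def late_last_iteration current_beep_def)
qed

text \<open>Answers begin exactly with the second half, so two of them give
  \<open>(Zero, Many)\<close>. This is not an answering vector, and the exit is counted from the
  processor's own beep.\<close>

lemma late_sync_round_eq:
  assumes "r \<in> H" "r' \<in> H" "r \<noteq> r'"
  shows "sync_round \<gamma> Spontaneous H = loop_beep \<gamma> k + 4 * \<gamma> + 1"
proof -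
  have ne: "H \<noteq> {}" using assms by blast
  let ?b = "loop_beep \<gamma> k"
  have 1: "H \<inter> {?b + 1..<?b + 1 + 2 * \<gamma>} = {}"
    and 2: "H \<inter> {?b + 1 + 2 * \<gamma>..<?b + 1 + 4 * \<gamma>} = H"
    using H by auto
  have "finite H" using H by (rule finite_subset) simp
  then have "card {r, r'} \<le> card H"
    using assms by (intro card_mono) auto
  with assms(3) have "2 \<le> card H" by simp
  then have "listen_vector \<gamma> H (?b + 1) = (Zero, Many)"
    unfolding listen_vector_def 1 2 by (simp add: amount_of_def)
  then have "\<not> answers \<gamma> H"
    by (simp add: answers_def current_beep_def late_last_iteration[OF ne])
  with k ne show ?thesis
    by (simp add: loop_completed_def late_last_iteration current_beep_def)
qed

end

section \<open>Runs in which nothing has been heard\<close>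

locale synchronisation =
  fixes \<gamma> :: nat and V :: "proc set" and wake :: schedule and s :: nat
  assumes \<gamma>_pos: "0 < \<gamma>"
    and first: "v \<in> V \<Longrightarrow> wake v = Some w \<Longrightarrow> s \<le> w"
begin

text \<open>As long as nothing has been heard, the run does not depend on the faults.\<close>

definition silent_status :: "nat \<Rightarrow> proc \<Rightarrow> status" where
  "silent_status t v =
     (case wake v of Some w \<Rightarrow> if w < t then Active Spontaneous w {} else Dormant | None \<Rightarrow> Dormant)"

definition silent_beep :: "nat \<Rightarrow> proc \<Rightarrow> bool" where
  "silent_beep t v \<longleftrightarrow> (\<exists>w k. wake v = Some w \<and> k < 3 * \<gamma> \<and> t = w + loop_beep \<gamma> k)"

text \<open>The processor that does not beep may still be dormant; a fault-free audible round then
  wakes it.\<close>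

definition audible :: "nat set" where
  "audible = {t. (\<exists>u\<in>V. silent_beep t u) \<and> (\<exists>v\<in>V. \<not> silent_beep t v)}"

text \<open>\<open>Suc t\<close> on the left because the spontaneous wake-ups of round
  \<open>t\<close> precede its beeps.\<close>

lemma beeps_silent_status: "beeps \<gamma> t (silent_status (Suc t) v) \<longleftrightarrow> silent_beep t v"
  using \<gamma>_pos
  by (auto simp: beeps_def silent_status_def silent_beep_def beeps_in_empty
      simp del: beeps_in.simps split: option.splits)

text \<open>Nobody wakes up before \<open>s\<close>, so nobody can have completed the loop by round
  \<open>t\<close>.\<close>

lemma start_round_silent:
  assumes "v \<in> V" "t < s + loop_beep \<gamma> (3 * \<gamma>)" "S v = silent_status t v"
  shows "start_round \<gamma> wake t S v = silent_status (Suc t) v"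
proof (cases "wake v")
  case None
  with assms(3) show ?thesis by (simp add: start_round_def silent_status_def)
next
  case (Some w)
  with assms(2) first[OF assms(1) Some] have "t - w \<noteq> loop_beep \<gamma> (3 * \<gamma>)" if "w < t"
    using that by linarith
  with Some assms(3) \<gamma>_pos show ?thesis
    by (auto simp: start_round_def silent_status_def sync_round_empty simp del: sync_round.simps)
qed

text \<open>In an inaudible round either nobody beeps or nobody listens; audible rounds are lost to
  faults.\<close>

lemma execution_silent:
  assumes "\<And>r. r < t \<Longrightarrow> r \<in> audible \<Longrightarrow> F r" "t \<le> s + loop_beep \<gamma> (3 * \<gamma>)" "v \<in> V"
  shows "execution \<gamma> V wake F t v = silent_status t v"
  using assms
proof (induction t arbitrary: v)
  case 0
  show ?case by (simp add: silent_status_def split: option.splits)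
next
  case (Suc t)
  have start: "start_round \<gamma> wake t (execution \<gamma> V wake F t) u = silent_status (Suc t) u"
    if "u \<in> V" for u
    using Suc that by (intro start_round_silent) auto
  show ?case
    using Suc.prems start by (auto simp: end_round_def beeps_silent_status audible_def)
qed

text \<open>All processors beep in the same rounds, so no round is audible and everybody completes
  the loop.\<close>

lemma simultaneous_termination:
  assumes "\<And>v. v \<in> V \<Longrightarrow> wake v = Some s" "v \<in> V"
  shows "terminates_at \<gamma> V wake F v (s + loop_beep \<gamma> (3 * \<gamma>))"
proof -
  define T where "T = s + loop_beep \<gamma> (3 * \<gamma>)"
  have "audible = {}" using assms(1) by (auto simp: audible_def silent_beep_def)
  then have "execution \<gamma> V wake F T v = silent_status T v"
    using assms(2) by (intro execution_silent) (auto simp: T_def)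
  also have "\<dots> = Active Spontaneous s {}"
    using assms \<gamma>_pos loop_beep_less_iff[of \<gamma> 0 "3 * \<gamma>"] by (simp add: silent_status_def T_def)
  finally have "start_round \<gamma> wake T (execution \<gamma> V wake F T) v = Terminated T"
    using \<gamma>_pos by (simp add: start_round_def sync_round_empty T_def del: sync_round.simps)
  then have "execution \<gamma> V wake F (Suc T) v = Terminated T"
    by (simp add: end_round_def)
  then show ?thesis unfolding terminates_at_def T_def by blast
qed

section \<open>The run after the first fault-free audible round\<close>

text \<open>
  The status before round \<open>t\<close> if \<open>\<tau>\<close> is the first fault-free audible round: those who
  beeped in round \<open>\<tau>\<close> listen, and all others answer in unison.
\<close>

definition answer_status :: "nat \<Rightarrow> (nat \<Rightarrow> bool) \<Rightarrow> nat \<Rightarrow> proc \<Rightarrow> status" where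
  "answer_status \<tau> F t v =
     (if silent_beep \<tau> v
      then Active Spontaneous (the (wake v))
             ((\<lambda>r. r - the (wake v)) ` {r. \<tau> + 2 * \<gamma> < r \<and> r < t \<and> \<not> F r})
      else (case wake v of
              Some w \<Rightarrow> if w \<le> \<tau> then Active Spontaneous w {\<tau> - w} else Active Beeped \<tau> {0}
            | None \<Rightarrow> Active Beeped \<tau> {0}))"

context
  fixes F :: "nat \<Rightarrow> bool" and \<tau> :: nat
  assumes \<tau>: "\<tau> \<in> audible" "\<not> F \<tau>" "\<And>r. r < \<tau> \<Longrightarrow> r \<in> audible \<Longrightarrow> F r"
    and \<tau>_le: "\<tau> \<le> s + loop_beep \<gamma> (2 * \<gamma> - 1)"
begin

text \<open>Up to round \<open>\<tau>\<close> nobody gets beyond iteration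
  \<open>2 * \<gamma> - 1\<close>, since nobody started before \<open>s\<close>. The last
  \<open>\<gamma>\<close> iterations are a reserve that keeps everybody out of the final
  one.\<close>

lemma iteration_bound:
  assumes "v \<in> V" "wake v = Some w" "w + loop_beep \<gamma> k \<le> \<tau>"
  shows "Suc k < 3 * \<gamma>"
proof -
  have "loop_beep \<gamma> k \<le> loop_beep \<gamma> (2 * \<gamma> - 1)"
    using first[OF assms(1,2)] assms(3) \<tau>_le by linarith
  then have "k \<le> 2 * \<gamma> - 1" by (simp only: loop_beep_le_iff)
  with \<gamma>_pos show ?thesis by linarith
qed

lemma beeper_cases:
  assumes "v \<in> V" "silent_beep \<tau> v"
  obtains w k where "wake v = Some w" "\<tau> = w + loop_beep \<gamma> k" "Suc k < 3 * \<gamma>"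
  using assms(2) iteration_bound[OF assms(1)] that by (auto simp: silent_beep_def)

text \<open>The local clock lies strictly inside a window: at its left end the processor would be
  beeping.\<close>

lemma listener_cases:
  assumes "v \<in> V" "\<not> silent_beep \<tau> v" "wake v = Some w" "w \<le> \<tau>"
  obtains k where "loop_beep \<gamma> k < \<tau> - w" "\<tau> - w < loop_beep \<gamma> (Suc k)" "Suc k < 3 * \<gamma>"
proof -
  obtain k where k: "loop_beep \<gamma> k \<le> \<tau> - w" "\<tau> - w < loop_beep \<gamma> (Suc k)"
    by (rule loop_beep_interval)
  then have "Suc k < 3 * \<gamma>" using assms by (intro iteration_bound[of v w]) auto
  moreover have "loop_beep \<gamma> k \<noteq> \<tau> - w"
  proof
    assume "loop_beep \<gamma> k = \<tau> - w"
    with assms(3,4) \<open>Suc k < 3 * \<gamma>\<close> have "silent_beep \<tau> v"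
      unfolding silent_beep_def by (intro exI[of _ w] exI[of _ k]) simp
    with assms(2) show False by simp
  qed
  ultimately show ?thesis using k(1) by (intro that[OF _ k(2)]) simp_all
qed

lemma execution_first_hearing:
  assumes "v \<in> V"
  shows "execution \<gamma> V wake F (Suc \<tau>) v = answer_status \<tau> F (Suc \<tau>) v"
proof -
  have "loop_beep \<gamma> (2 * \<gamma> - 1) < loop_beep \<gamma> (3 * \<gamma>)"
    using \<gamma>_pos by (simp only: loop_beep_less_iff)
  then have lt: "\<tau> < s + loop_beep \<gamma> (3 * \<gamma>)" using \<tau>_le by linarith
  have start: "start_round \<gamma> wake \<tau> (execution \<gamma> V wake F \<tau>) u = silent_status (Suc \<tau>) u"
    if "u \<in> V" for u
    using that lt \<tau>(3) by (intro start_round_silent execution_silent) auto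
  obtain u where u: "u \<in> V" "silent_beep \<tau> u" using \<tau>(1) by (auto simp: audible_def)
  show ?thesis
  proof (cases "silent_beep \<tau> v")
    case True
    with assms obtain w k where w: "wake v = Some w" "\<tau> = w + loop_beep \<gamma> k"
      by (rule beeper_cases)
    have "{r. \<tau> + 2 * \<gamma> < r \<and> r < Suc \<tau> \<and> \<not> F r} = {}" by auto
    then have "answer_status \<tau> F (Suc \<tau>) v = Active Spontaneous w {}"
      using True w by (simp only: answer_status_def) simp
    moreover have "execution \<gamma> V wake F (Suc \<tau>) v = silent_status (Suc \<tau>) v"
      using True assms start by (simp add: end_round_def beeps_silent_status)
    ultimately show ?thesis using w by (simp add: silent_status_def)
  next
    case False
    then have "u \<noteq> v" using u by auto
    then have "\<exists>u\<in>V. u \<noteq> v \<and> beeps \<gamma> \<tau> (start_round \<gamma> wake \<tau> (execution \<gamma> V wake F \<tau>) u)"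
      using u start by (auto simp: beeps_silent_status)
    with False \<tau>(2) have "execution \<gamma> V wake F (Suc \<tau>) v =
        (case silent_status (Suc \<tau>) v of
           Dormant \<Rightarrow> Active Beeped \<tau> {0}
         | Active c w H \<Rightarrow> Active c w (insert (\<tau> - w) H)
         | Terminated r \<Rightarrow> Terminated r)"
      by (simp add: end_round_def start[OF assms] beeps_silent_status)
    \<comment> \<open>A processor scheduled to wake up after \<open>\<tau>\<close> is still dormant
      and is woken by this beep, like one that never wakes up spontaneously.\<close>
    with False show ?thesis
      by (auto simp: answer_status_def silent_status_def split: option.splits)
  qed
qed

lemma heard_by_beeper:
  assumes "\<tau> = w + b" "t \<le> \<tau> + 4 * \<gamma> + 1"
  shows "(\<lambda>r. r - w) ` {r. \<tau> + 2 * \<gamma> < r \<and> r < t \<and> P r} \<subseteq> {b + 2 * \<gamma> + 1..b + 4 * \<gamma>}"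
  using assms by auto

lemma start_round_answer:
  assumes "v \<in> V" "\<tau> < t" "t \<le> \<tau> + 4 * \<gamma>" "S v = answer_status \<tau> F t v"
  shows "start_round \<gamma> wake t S v = answer_status \<tau> F t v"
proof (cases "silent_beep \<tau> v")
  case True
  with assms(1) obtain w k where wk: "wake v = Some w" "\<tau> = w + loop_beep \<gamma> k" "Suc k < 3 * \<gamma>"
    by (rule beeper_cases)
  have "loop_beep \<gamma> k + 4 * \<gamma> < sync_round \<gamma> Spontaneous
      ((\<lambda>r. r - w) ` {r. \<tau> + 2 * \<gamma> < r \<and> r < t \<and> \<not> F r})"
    using wk assms(3) by (intro late_sync_round heard_by_beeper) auto
  with True wk assms show ?thesis
    by (simp add: start_round_def answer_status_def del: sync_round.simps)
next
  case False
  show ?thesis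
  proof (cases "\<exists>w. wake v = Some w \<and> w \<le> \<tau>")
    case True
    then obtain w where w: "wake v = Some w" "w \<le> \<tau>" by blast
    with assms(1) False obtain k where
      "loop_beep \<gamma> k < \<tau> - w" "\<tau> - w < loop_beep \<gamma> (Suc k)" "Suc k < 3 * \<gamma>"
      by (elim listener_cases)
    note single_sync_round[OF this]
    with False w assms show ?thesis
      by (simp add: start_round_def answer_status_def del: sync_round.simps)
  next
    case False
    with \<open>\<not> silent_beep \<tau> v\<close> assms show ?thesis
      by (auto simp: start_round_def answer_status_def split: option.splits)
  qed
qed

text \<open>All answers are counted from the common round \<open>\<tau>\<close>, in which the
  listeners heard their only beep, so they coincide in global time.\<close>

lemma beeps_answer_status:
  assumes "v \<in> V" "\<tau> < t" "t \<le> \<tau> + 4 * \<gamma>"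
  shows "beeps \<gamma> t (answer_status \<tau> F t v) \<longleftrightarrow> \<not> silent_beep \<tau> v \<and> \<tau> + 2 * \<gamma> < t"
proof (cases "silent_beep \<tau> v")
  case True
  with assms(1) obtain w k where wk: "wake v = Some w" "\<tau> = w + loop_beep \<gamma> k" "Suc k < 3 * \<gamma>"
    by (rule beeper_cases)
  have "\<not> beeps_in \<gamma> Spontaneous ((\<lambda>r. r - w) ` {r. \<tau> + 2 * \<gamma> < r \<and> r < t \<and> \<not> F r}) (t - w)"
    using wk assms by (intro late_not_beeps_in[where k = k] heard_by_beeper) auto
  with True wk show ?thesis
    by (simp add: beeps_def answer_status_def del: beeps_in.simps)
next
  case False
  show ?thesis
  proof (cases "\<exists>w. wake v = Some w \<and> w \<le> \<tau>")
    case True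
    then obtain w where w: "wake v = Some w" "w \<le> \<tau>" by blast
    with assms(1) False obtain k where
      "loop_beep \<gamma> k < \<tau> - w" "\<tau> - w < loop_beep \<gamma> (Suc k)" "Suc k < 3 * \<gamma>"
      by (elim listener_cases)
    then have "beeps_in \<gamma> Spontaneous {\<tau> - w} (t - w) \<longleftrightarrow>
        t - w \<in> {\<tau> - w + 2 * \<gamma> + 1..\<tau> - w + 4 * \<gamma>}"
      using w assms by (intro single_beeps_in) auto
    with False w assms show ?thesis
      by (auto simp: beeps_def answer_status_def simp del: beeps_in.simps)
  next
    case False
    with \<open>\<not> silent_beep \<tau> v\<close> assms show ?thesis
      by (auto simp: beeps_def answer_status_def split: option.splits)
  qed
qed

text \<open>Answering processors beep simultaneously and never hear each other, so their histories
  stay fixed. Beepers hear exactly the answers in fault-free rounds.\<close>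

lemma execution_answer:
  assumes "v \<in> V" "Suc \<tau> \<le> t" "t \<le> \<tau> + 4 * \<gamma> + 1"
  shows "execution \<gamma> V wake F t v = answer_status \<tau> F t v"
  using assms(2,3,1)
proof (induction t arbitrary: v rule: dec_induct)
  case base
  then show ?case by (intro execution_first_hearing)
next
  case (step t)
  have start: "start_round \<gamma> wake t (execution \<gamma> V wake F t) u = answer_status \<tau> F t u"
    if "u \<in> V" for u
    using step that by (intro start_round_answer) auto
  have beep: "beeps \<gamma> t (start_round \<gamma> wake t (execution \<gamma> V wake F t) u) \<longleftrightarrow>
      \<not> silent_beep \<tau> u \<and> \<tau> + 2 * \<gamma> < t" if "u \<in> V" for u
    using step that start by (simp add: beeps_answer_status)
  \<comment> \<open>Audibility of \<open>\<tau>\<close> provides a processor that answers, so that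
    the beepers have something to hear.\<close>
  obtain u where u: "u \<in> V" "\<not> silent_beep \<tau> u" using \<tau>(1) by (auto simp: audible_def)
  show ?case
  proof (cases "silent_beep \<tau> v")
    case True
    have "(\<exists>u\<in>V. u \<noteq> v \<and> beeps \<gamma> t (start_round \<gamma> wake t (execution \<gamma> V wake F t) u)) \<longleftrightarrow>
        \<tau> + 2 * \<gamma> < t"
      using beep u True by metis
    moreover have "{r. \<tau> + 2 * \<gamma> < r \<and> r < Suc t \<and> \<not> F r} =
        (if \<tau> + 2 * \<gamma> < t \<and> \<not> F t then insert t {r. \<tau> + 2 * \<gamma> < r \<and> r < t \<and> \<not> F r}
         else {r. \<tau> + 2 * \<gamma> < r \<and> r < t \<and> \<not> F r})"
      by (auto simp: less_Suc_eq)
    ultimately show ?thesis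
      using True step.prems beep[OF step.prems(2)] start[OF step.prems(2)]
      by (simp add: end_round_def answer_status_def)
  next
    case False
    have "execution \<gamma> V wake F (Suc t) v = answer_status \<tau> F t v"
      using False step.prems beep start by (auto simp: end_round_def)
    with False show ?thesis by (simp add: answer_status_def)
  qed
qed

text \<open>Two fault-free answering rounds make every beeper exit \<open>4 * \<gamma> + 1\<close>
  rounds after its beep in round \<open>\<tau>\<close>; the others exit equally long after hearing
  it.\<close>

lemma answered_termination:
  assumes "v \<in> V"
    and "\<not> F r" "r \<in> {\<tau> + 2 * \<gamma> + 1..\<tau> + 4 * \<gamma>}"
    and "\<not> F r'" "r' \<in> {\<tau> + 2 * \<gamma> + 1..\<tau> + 4 * \<gamma>}"
    and "r \<noteq> r'"
  shows "terminates_at \<gamma> V wake F v (\<tau> + 4 * \<gamma> + 1)"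
proof -
  define T where "T = \<tau> + 4 * \<gamma> + 1"
  have ex: "execution \<gamma> V wake F T v = answer_status \<tau> F T v"
    using assms(1) by (intro execution_answer) (auto simp: T_def)
  have "start_round \<gamma> wake T (execution \<gamma> V wake F T) v = Terminated T"
  proof (cases "silent_beep \<tau> v")
    case True
    with assms(1) obtain w k where wk: "wake v = Some w" "\<tau> = w + loop_beep \<gamma> k" "Suc k < 3 * \<gamma>"
      by (rule beeper_cases)
    have "sync_round \<gamma> Spontaneous ((\<lambda>r. r - w) ` {r. \<tau> + 2 * \<gamma> < r \<and> r < T \<and> \<not> F r}) =
        loop_beep \<gamma> k + 4 * \<gamma> + 1"
      using wk assms
      by (intro late_sync_round_eq[where r = "r - w" and r' = "r' - w"] heard_by_beeper)
        (auto simp: T_def)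
    with True wk ex show ?thesis
      by (simp add: start_round_def answer_status_def T_def del: sync_round.simps)
  next
    case False
    show ?thesis
    proof (cases "\<exists>w. wake v = Some w \<and> w \<le> \<tau>")
      case True
      then obtain w where w: "wake v = Some w" "w \<le> \<tau>" by blast
      with assms(1) False obtain k where
        "loop_beep \<gamma> k < \<tau> - w" "\<tau> - w < loop_beep \<gamma> (Suc k)" "Suc k < 3 * \<gamma>"
        by (elim listener_cases)
      note single_sync_round[OF this]
      with False w ex show ?thesis
        by (simp add: start_round_def answer_status_def T_def del: sync_round.simps)
    next
      case False
      with \<open>\<not> silent_beep \<tau> v\<close> ex show ?thesis
        by (auto simp: start_round_def answer_status_def T_def split: option.splits)
    qed
  qed
  then have "execution \<gamma> V wake F (Suc T) v = Terminated T"
    by (simp add: end_round_def)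
  then show ?thesis unfolding terminates_at_def T_def by blast
qed

end

section \<open>Counting audible rounds\<close>

lemma many_audible:
  assumes "u \<in> V" "wake u = Some s" "v \<in> V" "wake v \<noteq> Some s"
  obtains J where "finite J" "card J = \<gamma>" "J \<subseteq> audible \<inter> {..s + loop_beep \<gamma> (2 * \<gamma> - 1)}"
proof -
  \<comment> \<open>The pairs are disjoint, so one audible round from each yields
    \<open>\<gamma>\<close> different ones. If both rounds of a pair were inaudible,
    \<open>v\<close> would beep in both together with \<open>u\<close>.\<close>
  have "\<exists>k\<in>{2 * m, Suc (2 * m)}. s + loop_beep \<gamma> k \<in> audible" if "m < \<gamma>" for m
  proof (rule ccontr)
    assume no: "\<not> ?thesis"
    have beep: "silent_beep (s + loop_beep \<gamma> k) v" if k: "k \<in> {2 * m, Suc (2 * m)}" for k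
    proof -
      have "silent_beep (s + loop_beep \<gamma> k) u"
        unfolding silent_beep_def using assms k \<open>m < \<gamma>\<close>
        by (intro exI[of _ s] exI[of _ k]) auto
      with no k assms(1,3) show ?thesis by (auto simp: audible_def simp del: loop_beep.simps)
    qed
    obtain w i where wi: "wake v = Some w" "s + loop_beep \<gamma> (2 * m) = w + loop_beep \<gamma> i"
      using beep[of "2 * m"] unfolding silent_beep_def by auto
    obtain j where "s + loop_beep \<gamma> (Suc (2 * m)) = w + loop_beep \<gamma> j"
      using beep[of "Suc (2 * m)"] wi(1) unfolding silent_beep_def by auto
    with wi(2) have "w = s"
      by (rule no_consecutive_collisions) (use that in simp)
    with wi(1) assms(4) show False by simp
  qed
  then obtain K where K: "\<And>m. m < \<gamma> \<Longrightarrow> K m \<in> {2 * m, Suc (2 * m)}"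
      "\<And>m. m < \<gamma> \<Longrightarrow> s + loop_beep \<gamma> (K m) \<in> audible"
    by metis
  have "inj_on (\<lambda>m. s + loop_beep \<gamma> (K m)) {..<\<gamma>}"
  proof (rule inj_onI)
    fix m n assume mn: "m \<in> {..<\<gamma>}" "n \<in> {..<\<gamma>}"
      and "s + loop_beep \<gamma> (K m) = s + loop_beep \<gamma> (K n)"
    then have "K m = K n" by (simp add: loop_beep_eq_iff)
    with K(1)[of m] K(1)[of n] mn show "m = n" by auto
  qed
  moreover have "s + loop_beep \<gamma> (K m) \<le> s + loop_beep \<gamma> (2 * \<gamma> - 1)" if "m < \<gamma>" for m
    using K(1)[OF that] that by (auto simp only: add_le_cancel_left loop_beep_le_iff)
  ultimately show ?thesis
    using K(2) by (intro that[of "(\<lambda>m. s + loop_beep \<gamma> (K m)) ` {..<\<gamma>}"]) (auto simp: card_image)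
qed

end

section \<open>Measurability and probabilities of fault patterns\<close>

lemma execution_cong:
  assumes "\<And>r. r < t \<Longrightarrow> F r = G r"
  shows "execution \<gamma> V wake F t = execution \<gamma> V wake G t"
  using assms by (induction t) simp_all

context
  fixes p :: real
  assumes p: "0 < p" "p < 1"
begin

lemma space_fault_space: "space (fault_space p) = UNIV"
  by (simp add: fault_space_def space_PiM)

lemma prob_space_fault_space: "prob_space (fault_space p)"
  unfolding fault_space_def by (intro prob_space_PiM measure_pmf.prob_space_axioms)

lemma sets_fault_space_coordinate [measurable]:
  "Measurable.pred (fault_space p) (\<lambda>F. F i)"
  unfolding fault_space_def by measurable

text \<open>Such a predicate is a finite disjunction of cylinders, one for each pattern of the first
  \<open>t\<close> faults; a pattern is coded by its set of faulty rounds.\<close>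

lemma sets_fault_space_finite:
  assumes "\<And>F G. (\<And>r. r < t \<Longrightarrow> F r = G r) \<Longrightarrow> P F = P G"
  shows "Measurable.pred (fault_space p) P"
proof -
  define \<A> where "\<A> = {A. A \<subseteq> {..<t} \<and> P (\<lambda>r. r \<in> A)}"
  have "P F \<longleftrightarrow> (\<exists>A\<in>\<A>. \<forall>r\<in>{..<t}. F r = (r \<in> A))" for F
  proof
    assume "P F"
    then have "P (\<lambda>r. r \<in> {r. r < t \<and> F r})" using assms[of F "\<lambda>r. r \<in> {r. r < t \<and> F r}"] by simp
    then show "\<exists>A\<in>\<A>. \<forall>r\<in>{..<t}. F r = (r \<in> A)"
      by (intro bexI[of _ "{r. r < t \<and> F r}"]) (auto simp: \<A>_def)
  next
    assume "\<exists>A\<in>\<A>. \<forall>r\<in>{..<t}. F r = (r \<in> A)"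
    then obtain A where "P (\<lambda>r. r \<in> A)" "\<forall>r\<in>{..<t}. F r = (r \<in> A)"
      by (auto simp: \<A>_def)
    with assms[of F "\<lambda>r. r \<in> A"] show "P F" by simp
  qed
  then have P: "P = (\<lambda>F. \<exists>A\<in>\<A>. \<forall>r\<in>{..<t}. F r = (r \<in> A))" by (rule ext)
  have "finite \<A>"
    by (rule finite_subset[of _ "Pow {..<t}"]) (auto simp: \<A>_def)
  then show ?thesis
    unfolding P by (intro pred_intros_finite) measurable
qed

lemma sets_faults:
  assumes "finite A" "finite B"
  shows "{F. (\<forall>r\<in>A. F r) \<and> (\<forall>r\<in>B. \<not> F r)} \<in> sets (fault_space p)"
proof -
  have "{F \<in> space (fault_space p). (\<forall>r\<in>A. F r) \<and> (\<forall>r\<in>B. \<not> F r)} \<in> sets (fault_space p)"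
    using assms by measurable
  then show ?thesis by (simp add: space_fault_space)
qed

lemma prob_faults:
  assumes "finite A" "finite B" "A \<inter> B = {}"
  shows "measure (fault_space p) {F. (\<forall>r\<in>A. F r) \<and> (\<forall>r\<in>B. \<not> F r)} = p ^ card A * (1 - p) ^ card B"
proof -
  interpret product_prob_space "\<lambda>_. measure_pmf (bernoulli_pmf p)" "UNIV :: nat set" ..
  let ?X = "\<lambda>r. if r \<in> A then {True} else {False}"
  have "{F. (\<forall>r\<in>A. F r) \<and> (\<forall>r\<in>B. \<not> F r)} =
      prod_emb UNIV (\<lambda>_. measure_pmf (bernoulli_pmf p)) (A \<union> B) (Pi\<^sub>E (A \<union> B) ?X)"
    using assms(3) by (auto simp: prod_emb_def PiE_def Pi_def split: if_splits)
  then have "measure (fault_space p) {F. (\<forall>r\<in>A. F r) \<and> (\<forall>r\<in>B. \<not> F r)} =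
      (\<Prod>r\<in>A \<union> B. measure (measure_pmf (bernoulli_pmf p)) (?X r))"
    unfolding fault_space_def using assms by (simp only:) (subst measure_PiM_emb, auto)
  also have "\<dots> = (\<Prod>r\<in>A. measure (measure_pmf (bernoulli_pmf p)) (?X r)) *
      (\<Prod>r\<in>B. measure (measure_pmf (bernoulli_pmf p)) (?X r))"
    using assms by (rule prod.union_disjoint)
  also have "(\<Prod>r\<in>A. measure (measure_pmf (bernoulli_pmf p)) (?X r)) = (\<Prod>r\<in>A. p)"
    using p by (intro prod.cong) (auto simp: measure_pmf_single)
  also have "(\<Prod>r\<in>B. measure (measure_pmf (bernoulli_pmf p)) (?X r)) = (\<Prod>r\<in>B. 1 - p)"
    using p assms(3) by (intro prod.cong) (auto simp: measure_pmf_single)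
  finally show ?thesis by simp
qed

text \<open>
  What follows the first fault-free round of \<open>R\<close> is independent of which round this is.
\<close>

lemma prob_faults_after_first_success:
  fixes R :: "nat set" and S :: "nat \<Rightarrow> nat set"
  defines "D \<equiv> \<lambda>t. {F. (\<forall>r\<in>R \<inter> {..<t} \<union> S t. F r) \<and> (\<forall>r\<in>{t}. \<not> F r)}"
  assumes R: "finite R" and S: "\<And>t. t \<in> R \<Longrightarrow> finite (S t) \<and> card (S t) = n \<and> S t \<subseteq> {t<..}"
  shows "(\<Union>t\<in>R. D t) \<in> sets (fault_space p)" and "measure (fault_space p) (\<Union>t\<in>R. D t) \<le> p ^ n"
proof -
  interpret prob_space "fault_space p" by (rule prob_space_fault_space)
  \<comment> \<open>For \<open>t\<close> in \<open>R\<close>, this is the event that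
    \<open>t\<close> is the first fault-free round of \<open>R\<close>. These events are disjoint,
    so their probabilities sum to at most 1.\<close>
  define E where "E t = {F. (\<forall>r\<in>R \<inter> {..<t}. F r) \<and> (\<forall>r\<in>{t}. \<not> F r)}" for t
  have D: "D t \<in> events" if "t \<in> R" for t
    unfolding D_def using R S[OF that] by (intro sets_faults) auto
  then show "(\<Union>t\<in>R. D t) \<in> events"
    using R by (intro sets.finite_UN)
  have E: "E t \<in> events" for t
    unfolding E_def using R by (intro sets_faults) auto
  have "E t \<inter> E u = {}" if "t \<in> R" "t < u" for t u
    using that by (auto simp: E_def)
  then have "disjoint_family_on E R"
    unfolding disjoint_family_on_def by (metis inf_commute linorder_neqE_nat)
  with R E have "(\<Sum>t\<in>R. prob (E t)) = prob (\<Union>t\<in>R. E t)"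
    by (intro finite_measure_finite_Union[symmetric]) auto
  then have sum: "(\<Sum>t\<in>R. prob (E t)) \<le> 1" by simp
  have prob: "prob (D t) = prob (E t) * p ^ n" if t: "t \<in> R" for t
  proof -
    \<comment> \<open>\<open>S t\<close> lies after \<open>t\<close>, so its faults contribute an
      independent factor \<open>p ^ n\<close>.\<close>
    have "card (R \<inter> {..<t} \<union> S t) = card (R \<inter> {..<t}) + card (S t)"
      using R S[OF t] by (intro card_Un_disjoint) auto
    moreover have "prob (D t) = p ^ card (R \<inter> {..<t} \<union> S t) * (1 - p) ^ card {t}"
      unfolding D_def using R S[OF t] by (intro prob_faults) auto
    moreover have "prob (E t) = p ^ card (R \<inter> {..<t}) * (1 - p) ^ card {t}"
      unfolding E_def using R by (intro prob_faults) auto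
    ultimately show ?thesis using S[OF t] by (simp add: power_add)
  qed
  have "prob (\<Union>t\<in>R. D t) \<le> (\<Sum>t\<in>R. prob (D t))"
    using R D by (intro finite_measure_subadditive_finite) auto
  also have "\<dots> = (\<Sum>t\<in>R. prob (E t)) * p ^ n"
    by (simp add: prob sum_distrib_right)
  also have "\<dots> \<le> 1 * p ^ n" using sum p by (intro mult_right_mono) auto
  finally show "prob (\<Union>t\<in>R. D t) \<le> p ^ n" by simp
qed

lemma sets_terminates_at [measurable]:
  "Measurable.pred (fault_space p) (\<lambda>F. terminates_at \<gamma> V wake F v r)"
proof -
  have [measurable]: "Measurable.pred (fault_space p) (\<lambda>F. execution \<gamma> V wake F t v = Terminated r)" for t
  proof (rule sets_fault_space_finite)
    fix F G :: "nat \<Rightarrow> bool"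
    assume "\<And>r. r < t \<Longrightarrow> F r = G r"
    then have "execution \<gamma> V wake F t = execution \<gamma> V wake G t" by (rule execution_cong)
    then show "(execution \<gamma> V wake F t v = Terminated r) = (execution \<gamma> V wake G t v = Terminated r)"
      by simp
  qed
  show ?thesis unfolding terminates_at_def by measurable
qed

end

section \<open>Union bound over the three ways to fail\<close>

theorem theorem2p1:
  fixes p \<epsilon> :: real and \<gamma> :: nat
  assumes "0 < p" and "p < 1" and "0 < \<epsilon>"
    and "0 < \<gamma>" and "p ^ \<gamma> < \<epsilon> / 4"
  shows "\<exists>C::nat. \<forall>(V :: proc set) (wake :: schedule).
    finite V \<and> V \<noteq> {} \<and> (\<exists>v\<in>V. wake v \<noteq> None) \<longrightarrow>
      measure (fault_space p)
        {F \<in> space (fault_space p).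
           \<exists>sync. (\<forall>v\<in>V. terminates_at \<gamma> V wake F v sync) \<and>
                  sync \<le> first_wakeup V wake + C} \<ge> 1 - \<epsilon>"
proof (intro exI[of _ "loop_beep \<gamma> (3 * \<gamma>)"] allI impI, elim conjE)
  fix V :: "proc set" and wake :: schedule
  assume V: "finite V" "V \<noteq> {}" and spontaneous: "\<exists>v\<in>V. wake v \<noteq> None"
  define s where "s = first_wakeup V wake"
  \<comment> \<open>The last of the first \<open>2 * \<gamma>\<close> beeps of a processor that
    wakes up in round \<open>s\<close>.\<close>
  define L where "L = s + loop_beep \<gamma> (2 * \<gamma> - 1)"
  define good where "good F \<longleftrightarrow> (\<exists>sync. (\<forall>v\<in>V. terminates_at \<gamma> V wake F v sync) \<and>
      sync \<le> s + loop_beep \<gamma> (3 * \<gamma>))" for F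
  have "\<exists>t. \<exists>v\<in>V. wake v = Some t" using spontaneous by auto
  then have "\<exists>v\<in>V. wake v = Some s"
    unfolding s_def first_wakeup_def by (rule LeastI_ex)
  then obtain u where u: "u \<in> V" "wake u = Some s" by blast
  interpret synchronisation \<gamma> V wake s
    by unfold_locales (use assms in \<open>auto simp: s_def first_wakeup_def intro: Least_le\<close>)
  interpret prob_space "fault_space p" using assms(1,2) by (rule prob_space_fault_space)
  note space = space_fault_space[OF assms(1,2)]
  note [measurable] = sets_terminates_at[OF assms(1,2)]
  have good_sets: "{F. good F} \<in> events"
  proof -
    have "{F \<in> space (fault_space p). good F} \<in> events"
      unfolding good_def using V(1) by measurable
    then show ?thesis by (simp add: space)
  qed
  have "1 - \<epsilon> \<le> prob {F. good F}"
  proof (cases "\<forall>v\<in>V. wake v = Some s")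
    case True
    then have "{F. good F} = space (fault_space p)"
      using simultaneous_termination by (auto simp: good_def space)
    with assms(3) show ?thesis by (simp add: prob_space)
  next
    case False
    then obtain v where "v \<in> V" "wake v \<noteq> Some s" by blast
    with u obtain J where J: "finite J" "card J = \<gamma>" "J \<subseteq> audible \<inter> {..L}"
      unfolding L_def by (rule many_audible)
    define R where "R = audible \<inter> {..L}"
    define D where "D S = (\<Union>t\<in>R. {F. (\<forall>r\<in>R \<inter> {..<t} \<union> S t. F r) \<and> (\<forall>r\<in>{t}. \<not> F r)})"
      for S :: "nat \<Rightarrow> nat set"
    \<comment> \<open>\<open>S1\<close> and \<open>S2\<close> are the two halves of the answering
      interval, with \<open>\<gamma>\<close> rounds each.\<close>
    define S1 where "S1 t = {t + 2 * \<gamma> + 1..t + 3 * \<gamma>}" for t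
    define S2 where "S2 t = {t + 3 * \<gamma> + 1..t + 4 * \<gamma>}" for t
    \<comment> \<open>\<open>J\<close> instead of \<open>R\<close>, because its cardinality is
      exactly \<open>\<gamma>\<close>; the empty set brings the event into the form of
      \<open>prob_faults\<close>.\<close>
    define N where "N = {F. (\<forall>r\<in>J. F r) \<and> (\<forall>r\<in>{}. \<not> F r)}"
    have "finite R" by (simp add: R_def)
    have D1: "D S1 \<in> events" "prob (D S1) \<le> p ^ \<gamma>"
      unfolding D_def using \<open>finite R\<close>
      by (intro prob_faults_after_first_success[OF assms(1,2)]; auto simp: S1_def)+
    have D2: "D S2 \<in> events" "prob (D S2) \<le> p ^ \<gamma>"
      unfolding D_def using \<open>finite R\<close>
      by (intro prob_faults_after_first_success[OF assms(1,2)]; auto simp: S2_def)+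
    have N: "N \<in> events"
      unfolding N_def using J(1) by (intro sets_faults[OF assms(1,2)]) auto
    have "prob N = p ^ card J * (1 - p) ^ card ({} :: nat set)"
      unfolding N_def using J(1) by (intro prob_faults[OF assms(1,2)]) auto
    then have pN: "prob N = p ^ \<gamma>" using J(2) by simp
    have "good F" if "F \<notin> N" "F \<notin> D S1" "F \<notin> D S2" for F
    proof -
      have "\<exists>t. t \<in> R \<and> \<not> F t" using \<open>F \<notin> N\<close> J(3) by (auto simp: N_def R_def)
      then obtain \<tau> where \<tau>: "\<tau> \<in> R" "\<not> F \<tau>" and least: "\<And>r. r < \<tau> \<Longrightarrow> r \<in> R \<Longrightarrow> F r"
        using exists_least_iff[of "\<lambda>t. t \<in> R \<and> \<not> F t"] by blast
      have "\<tau> \<in> audible" "\<tau> \<le> L" using \<tau>(1) by (auto simp: R_def)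
      have before: "F r" if "r < \<tau>" "r \<in> audible" for r
        using that \<open>\<tau> \<le> L\<close> by (intro least) (auto simp: R_def)
      obtain r where r: "r \<in> S1 \<tau>" "\<not> F r"
        using \<open>F \<notin> D S1\<close> \<tau> least by (auto simp: D_def)
      obtain r' where r': "r' \<in> S2 \<tau>" "\<not> F r'"
        using \<open>F \<notin> D S2\<close> \<tau> least by (auto simp: D_def)
      have "terminates_at \<gamma> V wake F v (\<tau> + 4 * \<gamma> + 1)" if "v \<in> V" for v
        using \<open>\<tau> \<in> audible\<close> \<open>\<not> F \<tau>\<close> before \<open>\<tau> \<le> L\<close>[unfolded L_def] that
        by (rule answered_termination[where r = r and r' = r'])
          (use r r' in \<open>auto simp: S1_def S2_def\<close>)
      moreover have "\<tau> + 4 * \<gamma> + 1 \<le> s + loop_beep \<gamma> (3 * \<gamma>)"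
      proof -
        \<comment> \<open>The gap after \<open>L\<close> is \<open>6 * \<gamma>\<close>, which is at
          least \<open>4 * \<gamma> + 1\<close>.\<close>
        have "loop_beep \<gamma> (Suc (2 * \<gamma> - 1)) \<le> loop_beep \<gamma> (3 * \<gamma>)"
          using \<gamma>_pos by (simp only: loop_beep_le_iff)
        with \<open>\<tau> \<le> L\<close> show ?thesis by (simp add: L_def)
      qed
      ultimately show ?thesis unfolding good_def by blast
    qed
    then have "space (fault_space p) \<subseteq> {F. good F} \<union> (N \<union> (D S1 \<union> D S2))" by blast
    then have "prob (space (fault_space p)) \<le> prob ({F. good F} \<union> (N \<union> (D S1 \<union> D S2)))"
      using good_sets N D1(1) D2(1) by (intro finite_measure_mono) auto
    also have "\<dots> \<le> prob {F. good F} + prob (N \<union> (D S1 \<union> D S2))"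
      using good_sets N D1(1) D2(1) by (intro measure_Un_le) auto
    also have "prob (N \<union> (D S1 \<union> D S2)) \<le> prob N + prob (D S1 \<union> D S2)"
      using N D1(1) D2(1) by (intro measure_Un_le) auto
    also have "prob (D S1 \<union> D S2) \<le> prob (D S1) + prob (D S2)"
      using D1(1) D2(1) by (intro measure_Un_le) auto
    \<comment> \<open>The failure probability is at most \<open>3 * p ^ \<gamma>\<close>, which is
      less than \<open>3 * \<epsilon> / 4\<close>.\<close>
    finally show ?thesis using D1(2) D2(2) pN assms(3,5) by (simp add: prob_space)
  qed
  then show "1 - \<epsilon> \<le> prob {F \<in> space (fault_space p).
      \<exists>sync. (\<forall>v\<in>V. terminates_at \<gamma> V wake F v sync) \<and>
        sync \<le> first_wakeup V wake + loop_beep \<gamma> (3 * \<gamma>)}"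
    by (simp add: good_def s_def space)
qed

end
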